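(* Let $\mathbb{O}$ be the real octonion algebra with a fixed standard basis $\boldsymbol e_1=1,\boldsymbol e_2,\dots,\boldsymbol e_8$ (as specified in the context). Let $a,b,c,d,e,f,g,h,p,q,r,s,t,u,v,w$ be 16 commuting variables, and let $$A = a\boldsymbol e_1+b\boldsymbol e_2+c\boldsymbol e_3+d\boldsymbol e_4+e\boldsymbol e_5+f\boldsymbol e_6+g\boldsymbol e_7+h\boldsymbol e_8,$$ $$P = p\boldsymbol e_1+q\boldsymbol e_2+r\boldsymbol e_3+s\boldsymbol e_4+t\boldsymbol e_5+u\boldsymbol e_6+v\boldsymbol e_7+w\boldsymbol e_8$$ be the corresponding symbolic octonions in $\mathbb{O}[a,\dots,h,p,\dots,w]=\mathbb{O}\otimes_{\mathbb R}\mathbb{R}[a,\dots,h,p,\dots,w]$. Let $M\in\mathbb{R}[a,\dots,h,p,\dots,w]^{8\times 8}$ be the matrix whose $i$-th row ($1\le i\le 8$) is the vector of components of the octonion $A(\boldsymbol e_i P)$ with respect to $\boldsymbol e_1,\dots,\boldsymbol e_8$. Then $M$ is a symbolic semi-magic square of squares with entries in $\mathbb{Z}[a,\dots,h,p,\dots,w]$, with orthogonal rows and constant $N(A)N(P)$. That is: all entries of $M$ lie in $\mathbb{Z}[a,\dots,h,p,\dots,w]$, the 64 entries of $M$ are pairwise distinct polynomials, and $MM^\top=M^\top M=N(A)N(P)\, I_8$. Consequently, if $A_0,P_0\in\mathbb{Q}^8$ are such that the matrix $M_0$ obtained from $M$ by substituting the coordinates of $A_0$ for $(a,\dots,h)$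 and those of $P_0$ for $(p,\dots,w)$ has 64 pairwise distinct integer entries, then $M_0$ is an integral semi-magic square of squares with orthogonal rows and constant $N(A_0)N(P_0)$, i.e. $M_0$ is an integer matrix with pairwise distinct entries and $M_0M_0^\top=M_0^\top M_0=N(A_0)N(P_0)\, I_8$.
   Context: The octonions $\mathbb{O}$ are the 8-dimensional non-associative real normed division algebra obtained from the quaternions by the Cayley–Dickson construction. The standard basis $\boldsymbol e_1=1,\boldsymbol e_2,\dots,\boldsymbol e_8$ of $\mathbb{O}$ is orthonormal with respect to the norm form, and the product of any two basis elements is $\pm$ a basis element (e.g. the usual basis arising from the Cayley–Dickson construction). The multiplication is extended bilinearly to octonions with polynomial coefficients, the variables commuting with everything. The norm is $N\left(\sum_{i=1}^8 x_i\boldsymbol e_i\right)=\sum_{i=1}^8 x_i^2$; thus $N(A)=a^2+b^2+\dots+h^2$ and $N(P)=p^2+q^2+\dots+w^2$. Vectors in $\mathbb{Q}^8$ are identified with octonions via the basis $\boldsymbol e_1,\dots,\boldsymbol e_8$. A semi-magic square of squares with constant $\kappa$ (and orthogonal rows) is a square matrix $M$, with integer entries (or polynomial entries, in the symbolic case), whose entries are pairwise distinct and which satisfies $MM^\top=M^\top M=\kappa I$; in particular the sum of squares of the entries in each row and in each column equals $\kappa$. No condition is imposed on the diagonals (the prefix "semi" refers to the absence of the diagonal conditions). *)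

theory Defs
  imports "HOL-Analysis.Analysis" "HOL-Library.Poly_Mapping"
begin

section \<open>Octonions by Cayley--Dickson doubling\<close>

text \<open>
  Both doubling steps use (a, b)(c, d) = (ac - d* b, da + b c*) and (a, b)* = (a*, -b).
  Vector space structure, norm and inner product are the library's ones on product types, so that
  \<^term>\<open>x \<bullet> x\<close> is the norm form.
\<close>

type_synonym quaternion = "complex \<times> complex"
type_synonym octonion = "quaternion \<times> quaternion"

definition quat_cnj :: "quaternion \<Rightarrow> quaternion" where
  "quat_cnj x = (cnj (fst x), - snd x)"

definition quat_mult :: "quaternion \<Rightarrow> quaternion \<Rightarrow> quaternion" where
  "quat_mult x y =
     (fst x * fst y - cnj (snd y) * snd x, snd y * fst x + snd x * cnj (fst y))"

definition oct_mult :: "octonion \<Rightarrow> octonion \<Rightarrow> octonion" where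
  "oct_mult x y =
     (quat_mult (fst x) (fst y) - quat_mult (quat_cnj (snd y)) (snd x),
      quat_mult (snd y) (fst x) + quat_mult (snd x) (quat_cnj (fst y)))"

definition oct_one :: octonion where
  "oct_one = ((1, 0), (0, 0))"

text \<open>
  Bases are indexed by the eight-element type \<^typ>\<open>8\<close>, with elements 1, ..., 7 and 8 = 0.
  Eight orthonormal vectors automatically span the octonions.
\<close>

definition standard_basis :: "(8 \<Rightarrow> octonion) \<Rightarrow> bool" where
  "standard_basis e \<longleftrightarrow>
     e 1 = oct_one \<and>
     (\<forall>i j. e i \<bullet> e j = (if i = j then 1 else 0)) \<and>
     (\<forall>i j. \<exists>k. oct_mult (e i) (e j) = e k \<or> oct_mult (e i) (e j) = - e k)"


section \<open>Polynomials in sixteen variables\<close>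

text \<open>
  A polynomial is a finitely supported map from monomials to coefficients, and a monomial a finitely
  supported map from variables to exponents. The variables Inl 1, ..., Inl 8 are a, ..., h and
  Inr 1, ..., Inr 8 are p, ..., w.
\<close>

type_synonym poly16 = "((8 + 8) \<Rightarrow>\<^sub>0 nat) \<Rightarrow>\<^sub>0 real"

definition Const :: "real \<Rightarrow> poly16" where
  "Const c = Poly_Mapping.single 0 c"

definition Var :: "8 + 8 \<Rightarrow> poly16" where
  "Var x = Poly_Mapping.single (Poly_Mapping.single x 1) 1"

definition int_polys :: "poly16 set" where
  "int_polys = {f. \<forall>m. Poly_Mapping.lookup f m \<in> \<int>}"

definition eval_poly :: "(8 + 8 \<Rightarrow> real) \<Rightarrow> poly16 \<Rightarrow> real" where
  "eval_poly \<nu> f =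
     (\<Sum>m\<in>Poly_Mapping.keys f. Poly_Mapping.lookup f m * (\<Prod>x\<in>UNIV. \<nu> x ^ Poly_Mapping.lookup m x))"


section \<open>Octonions with polynomial coefficients\<close>

text \<open>
  Relative to a basis e of the octonions, the element \<open>\<Sum>k. X $ k \<otimes> e k\<close> of the scalar extension is
  given by its vector X of components. The product is the bilinear extension of the octonion product;
  for a basis e, \<open>representation (range e) x (e m)\<close> is the component of x at e m.
\<close>

definition poly_oct_mult :: "(8 \<Rightarrow> octonion) \<Rightarrow> poly16 ^ 8 \<Rightarrow> poly16 ^ 8 \<Rightarrow> poly16 ^ 8" where
  "poly_oct_mult e X Y =
     (\<chi> m. \<Sum>k\<in>UNIV. \<Sum>l\<in>UNIV.
        Const (representation (range e) (oct_mult (e k) (e l)) (e m)) * (X $ k) * (Y $ l))"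

definition of_oct :: "(8 \<Rightarrow> octonion) \<Rightarrow> octonion \<Rightarrow> poly16 ^ 8" where
  "of_oct e x = (\<chi> m. Const (representation (range e) x (e m)))"

definition norm_form :: "'a::comm_ring_1 ^ 8 \<Rightarrow> 'a" where
  "norm_form X = (\<Sum>i\<in>UNIV. (X $ i)\<^sup>2)"

definition symA :: "poly16 ^ 8" where
  "symA = (\<chi> i. Var (Inl i))"

definition symP :: "poly16 ^ 8" where
  "symP = (\<chi> i. Var (Inr i))"

definition symM :: "(8 \<Rightarrow> octonion) \<Rightarrow> poly16 ^ 8 ^ 8" where
  "symM e = (\<chi> i. poly_oct_mult e symA (poly_oct_mult e (of_oct e (e i)) symP))"

definition subst_matrix :: "real ^ 8 \<Rightarrow> real ^ 8 \<Rightarrow> poly16 ^ 8 ^ 8 \<Rightarrow> real ^ 8 ^ 8" where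
  "subst_matrix A0 P0 M = (\<chi> i j. eval_poly (case_sum (($) A0) (($) P0)) (M $ i $ j))"


section \<open>Semi-magic squares of squares\<close>

definition entries_in :: "'a set \<Rightarrow> 'a ^ 'n ^ 'n \<Rightarrow> bool" where
  "entries_in R M \<longleftrightarrow> (\<forall>i j. M $ i $ j \<in> R)"

definition distinct_entries :: "'a ^ 'n ^ 'n \<Rightarrow> bool" where
  "distinct_entries M \<longleftrightarrow>
     (\<forall>i j i' j'. M $ i $ j = M $ i' $ j' \<longrightarrow> i = i' \<and> j = j')"

text \<open>
  R is the set of admissible entries: the integers, or the polynomials with integer coefficients.
  \<^term>\<open>mat \<kappa>\<close> is \<kappa> times the identity matrix.
\<close>

definition semi_magic_square_of_squares :: "'a::comm_ring_1 set \<Rightarrow> 'a \<Rightarrow> 'a ^ 'n ^ 'n \<Rightarrow> bool" where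
  "semi_magic_square_of_squares R \<kappa> M \<longleftrightarrow>
     entries_in R M \<and> distinct_entries M \<and>
     M ** transpose M = mat \<kappa> \<and> transpose M ** M = mat \<kappa>"


section \<open>Sanity checks\<close>

lemma norm_oct_mult: "norm (oct_mult x y) = norm x * norm y"
proof -
  obtain a b c d e f g h where x: "x = ((Complex a b, Complex c d), (Complex e f, Complex g h))"
    by (metis complex.exhaust surj_pair)
  obtain p q r s t u v w where y: "y = ((Complex p q, Complex r s), (Complex t u, Complex v w))"
    by (metis complex.exhaust surj_pair)
  have "(norm (oct_mult x y))\<^sup>2 = (norm x * norm y)\<^sup>2"
    unfolding power_mult_distrib power2_norm_eq_inner
    by (simp add: x y oct_mult_def quat_mult_def quat_cnj_def inner_complex_def algebra_simps)
  then show ?thesis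
    by (simp add: power2_eq_iff_nonneg)
qed

definition cayley_dickson_basis :: "8 \<Rightarrow> octonion" where
  "cayley_dickson_basis i =
     (if i = 1 then ((1, 0), (0, 0)) else if i = 2 then ((\<i>, 0), (0, 0))
      else if i = 3 then ((0, 1), (0, 0)) else if i = 4 then ((0, \<i>), (0, 0))
      else if i = 5 then ((0, 0), (1, 0)) else if i = 6 then ((0, 0), (\<i>, 0))
      else if i = 7 then ((0, 0), (0, 1)) else ((0, 0), (0, \<i>)))"

lemma forall_8: "(\<forall>i::8. P i) \<longleftrightarrow> P 1 \<and> P 2 \<and> P 3 \<and> P 4 \<and> P 5 \<and> P 6 \<and> P 7 \<and> P 8"
proof -
  have "i = 1 \<or> i = 2 \<or> i = 3 \<or> i = 4 \<or> i = 5 \<or> i = 6 \<or> i = 7 \<or> i = 8" for i :: 8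
  proof (induct i)
    case (of_int z)
    then have "z = 0 \<or> z = 1 \<or> z = 2 \<or> z = 3 \<or> z = 4 \<or> z = 5 \<or> z = 6 \<or> z = 7"
      by simp arith
    then show ?case by auto
  qed
  then show ?thesis by metis
qed

lemma exists_8: "(\<exists>i::8. P i) \<longleftrightarrow> P 1 \<or> P 2 \<or> P 3 \<or> P 4 \<or> P 5 \<or> P 6 \<or> P 7 \<or> P 8"
  using forall_8[of "\<lambda>i. \<not> P i"] by blast

lemma standard_basis_cayley_dickson: "standard_basis cayley_dickson_basis"
proof -
  let ?e = cayley_dickson_basis
  have e: "?e 1 = ((1, 0), (0, 0))" "?e 2 = ((\<i>, 0), (0, 0))"
    "?e 3 = ((0, 1), (0, 0))" "?e 4 = ((0, \<i>), (0, 0))"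
    "?e 5 = ((0, 0), (1, 0))" "?e 6 = ((0, 0), (\<i>, 0))"
    "?e 7 = ((0, 0), (0, 1))" "?e 8 = ((0, 0), (0, \<i>))"
    by (simp_all add: cayley_dickson_basis_def)
  have "\<forall>i j. ?e i \<bullet> ?e j = (if i = j then 1 else 0)"
    unfolding forall_8 e by (simp add: inner_complex_def)
  moreover have "\<forall>i j. \<exists>k. oct_mult (?e i) (?e j) = ?e k \<or> oct_mult (?e i) (?e j) = - ?e k"
    unfolding forall_8 exists_8 e by (simp add: oct_mult_def quat_mult_def quat_cnj_def zero_prod_def)
  ultimately show ?thesis
    by (simp add: standard_basis_def e oct_one_def)
qed

end

theory Submission
  imports Defs
begin

text \<open>
  The entry in row i and column m is \<open>\<Sum>k l. C(i, m, k, l) a_k p_l\<close> with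
  \<open>C(i, m, k, l) = \<langle>e_k (e_i e_l), e_m\<rangle> \<in> {0, 1, -1}\<close>. By the polarised composition identities
  \<open>\<langle>x y, x' z\<rangle> + \<langle>x' y, x z\<rangle> = 2 \<langle>x, x'\<rangle> \<langle>y, z\<rangle>\<close> and their mirror images, the off-diagonal
  coefficients of the products of rows, and likewise of columns, cancel in pairs; this works over every
  commutative ring that receives a ring homomorphism from the reals, so it covers both the symbolic
  and the numerical matrix.

  Equal entries (i, m) and (i', m') have equal coefficients, which means
  \<open>v'* (v x) = (x u) u'*\<close> for all x, where \<open>u = e_i\<close>, \<open>u' = e_i'\<close>, \<open>v = e_m\<close>, \<open>v' = e_m'\<close>. At x = 1 both
  sides are \<open>c = v'* v = u u'*\<close>, a basis element up to sign. If the entries were different, c would be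
  imaginary, and a basis element x can be chosen at which the identity says \<open>x c = c x\<close> although
  x and c are orthogonal and imaginary, hence anticommute.
\<close>

subsection \<open>Octonion identities\<close>

definition oct_cnj :: "octonion \<Rightarrow> octonion" where
  "oct_cnj x = (quat_cnj (fst x), - snd x)"

lemmas oct_defs = oct_mult_def oct_cnj_def quat_mult_def quat_cnj_def oct_one_def

lemma bilinear_oct_mult: "bilinear oct_mult"
  unfolding bilinear_def
  by (intro conjI allI linearI)
    (simp_all add: oct_defs prod_eq_iff scaleR_conv_of_real ring_distribs mult_ac)

lemma linear_oct_cnj: "linear oct_cnj"
  by (intro linearI) (simp_all add: oct_defs)

lemma oct_mult_one [simp]: "oct_mult oct_one x = x" "oct_mult x oct_one = x"
  by (simp_all add: oct_defs prod_eq_iff)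

lemma oct_cnj_one [simp]: "oct_cnj oct_one = oct_one"
  by (simp add: oct_defs)

lemma oct_cnj_cnj [simp]: "oct_cnj (oct_cnj x) = x"
  by (simp add: oct_defs)

lemma oct_cnj_mult: "oct_cnj (oct_mult x y) = oct_mult (oct_cnj y) (oct_cnj x)"
  by (simp add: oct_defs prod_eq_iff mult_ac)

lemma oct_cnj_imaginary: "x \<bullet> oct_one = 0 \<Longrightarrow> oct_cnj x = - x"
  by (simp add: oct_defs inner_prod_def inner_complex_def prod_eq_iff complex_eq_iff)

lemma inner_oct_cnj: "oct_cnj x \<bullet> oct_cnj y = x \<bullet> y"
  by (simp add: oct_defs inner_prod_def inner_complex_def)

text \<open>Rewrites real inner products as polynomials in complex components and their conjugates,
  so that the octonion identities below become commutative ring algebra.\<close>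

lemma inner_complex_cnj: "complex_of_real (2 * (z \<bullet> w)) = z * cnj w + cnj z * w"
  by (simp add: inner_complex_def complex_eq_iff)

lemma inner_oct_mult_left: "oct_mult x y \<bullet> z = y \<bullet> oct_mult (oct_cnj x) z"
proof -
  have "complex_of_real (2 * (oct_mult x y \<bullet> z)) = complex_of_real (2 * (y \<bullet> oct_mult (oct_cnj x) z))"
    unfolding inner_prod_def distrib_left of_real_add inner_complex_cnj
    by (simp add: oct_defs algebra_simps)
  then show ?thesis
    unfolding of_real_eq_iff by simp
qed

lemma inner_oct_mult_right: "oct_mult x y \<bullet> z = x \<bullet> oct_mult z (oct_cnj y)"
proof -
  have "complex_of_real (2 * (oct_mult x y \<bullet> z)) = complex_of_real (2 * (x \<bullet> oct_mult z (oct_cnj y)))"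
    unfolding inner_prod_def distrib_left of_real_add inner_complex_cnj
    by (simp add: oct_defs algebra_simps)
  then show ?thesis
    unfolding of_real_eq_iff by simp
qed

text \<open>Polarised alternativity: the diagonal case \<open>x = z\<close> is twice the
  cancellation law. Together with its mirror image, it stands in for associativity.\<close>

lemma oct_mult_cnj_left:
  "oct_mult (oct_cnj x) (oct_mult z y) + oct_mult (oct_cnj z) (oct_mult x y) = (2 * (x \<bullet> z)) *\<^sub>R y"
  unfolding prod_eq_iff inner_prod_def distrib_left scaleR_prod_def fst_conv snd_conv
    scaleR_conv_of_real of_real_add inner_complex_cnj
  by (simp add: oct_defs algebra_simps)

lemma oct_mult_cnj_right:
  "oct_mult (oct_mult y x) (oct_cnj z) + oct_mult (oct_mult y z) (oct_cnj x) = (2 * (x \<bullet> z)) *\<^sub>R y"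
  unfolding prod_eq_iff inner_prod_def distrib_left scaleR_prod_def fst_conv snd_conv
    scaleR_conv_of_real of_real_add inner_complex_cnj
  by (simp add: oct_defs algebra_simps)

lemmas oct_mult_minus = bilinear_lneg[OF bilinear_oct_mult] bilinear_rneg[OF bilinear_oct_mult]

lemma double_eq_scaleR:
  fixes a c :: "'a::real_vector"
  assumes "a + a = (2 * r) *\<^sub>R c"
  shows "a = r *\<^sub>R c"
proof -
  have "2 *\<^sub>R a = 2 *\<^sub>R r *\<^sub>R c"
    using assms by (simp only: scaleR_scaleR scaleR_2)
  then show ?thesis
    unfolding scaleR_cancel_left by simp
qed

lemma oct_cancel_left: "oct_mult (oct_cnj x) (oct_mult x y) = (x \<bullet> x) *\<^sub>R y"
  by (rule double_eq_scaleR) (rule oct_mult_cnj_left)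

lemma oct_cancel_right: "oct_mult (oct_mult y x) (oct_cnj x) = (x \<bullet> x) *\<^sub>R y"
  by (rule double_eq_scaleR) (rule oct_mult_cnj_right)

lemma oct_cancel [simp]:
  "oct_mult x (oct_cnj x) = (x \<bullet> x) *\<^sub>R oct_one"
  "oct_mult (oct_cnj x) x = (x \<bullet> x) *\<^sub>R oct_one"
  using oct_cancel_left[of x oct_one] oct_cancel_right[of oct_one x] by simp_all

text \<open>Conjugation negates imaginary elements, and orthogonality makes the right-hand side of
  the polarised identities vanish. The last claim is the first one at
  \<open>y = oct_one\<close>.\<close>

lemma oct_imaginary_anticommute:
  assumes "x \<bullet> oct_one = 0" "z \<bullet> oct_one = 0" "x \<bullet> z = 0"
  shows "oct_mult x (oct_mult z y) = - oct_mult z (oct_mult x y)"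
    and "oct_mult (oct_mult y x) z = - oct_mult (oct_mult y z) x"
    and "oct_mult x z = - oct_mult z x"
proof -
  show *: "oct_mult x (oct_mult z y) = - oct_mult z (oct_mult x y)" for y
    using oct_mult_cnj_left[of x z y] assms
    by (simp add: oct_cnj_imaginary oct_mult_minus) (metis minus_minus)
  show "oct_mult (oct_mult y x) z = - oct_mult (oct_mult y z) x"
    using oct_mult_cnj_right[of y x z] assms
    by (simp add: oct_cnj_imaginary oct_mult_minus) (metis minus_minus)
  show "oct_mult x z = - oct_mult z x"
    using *[of oct_one] by simp
qed

text \<open>The product equals its own negative, hence is zero, and multiplicativity of the norm
  excludes zero divisors.\<close>

lemma oct_imaginary_commute:
  assumes "x \<bullet> oct_one = 0" "z \<bullet> oct_one = 0" "x \<bullet> z = 0" "oct_mult x z = oct_mult z x"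
  shows "x = 0 \<or> z = 0"
proof -
  have "oct_mult x z = - oct_mult x z"
    using oct_imaginary_anticommute(3)[OF assms(1-3)] assms(4) by simp
  then have "oct_mult x z = 0"
    by (simp add: eq_neg_iff_add_eq_0 flip: scaleR_2)
  then show ?thesis
    using norm_oct_mult[of x z] by simp
qed

lemma oct_mult_inner_left:
  "oct_mult x y \<bullet> oct_mult x' z + oct_mult x' y \<bullet> oct_mult x z = 2 * (x \<bullet> x') * (y \<bullet> z)"
proof -
  have "oct_mult x y \<bullet> oct_mult x' z + oct_mult x' y \<bullet> oct_mult x z =
      y \<bullet> (oct_mult (oct_cnj x) (oct_mult x' z) + oct_mult (oct_cnj x') (oct_mult x z))"
    by (simp add: inner_oct_mult_left inner_add_right)
  then show ?thesis
    by (simp add: oct_mult_cnj_left)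
qed

lemma oct_mult_inner_right:
  "oct_mult y x \<bullet> oct_mult z x' + oct_mult y x' \<bullet> oct_mult z x = 2 * (x \<bullet> x') * (y \<bullet> z)"
proof -
  have "oct_mult y x \<bullet> oct_mult z x' + oct_mult y x' \<bullet> oct_mult z x =
      y \<bullet> (oct_mult (oct_mult z x') (oct_cnj x) + oct_mult (oct_mult z x) (oct_cnj x'))"
    by (simp add: inner_oct_mult_right inner_add_right)
  then show ?thesis
    by (simp add: oct_mult_cnj_right inner_commute)
qed

text \<open>Orthogonality gives independence and the dimension count gives spanning. Components
  thereby become inner products, and Parseval's identity evaluates sums over basis indices.\<close>

lemma orthonormal_family_expansion:
  fixes e :: "'n::finite \<Rightarrow> 'a::euclidean_space"
  assumes orth: "\<And>i j. e i \<bullet> e j = (if i = j then 1 else 0)" and card: "CARD('n) = DIM('a)"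
  shows "independent (range e)" and "span (range e) = UNIV"
    and "representation (range e) x (e m) = x \<bullet> e m"
    and "(\<Sum>m\<in>UNIV. (x \<bullet> e m) *\<^sub>R e m) = x"
    and "(\<Sum>m\<in>UNIV. (x \<bullet> e m) * (y \<bullet> e m)) = x \<bullet> y"
proof -
  have inj: "inj e"
  proof (rule injI)
    fix i j assume "e i = e j"
    then show "i = j" using orth[of i j] orth[of i i] by (auto split: if_splits)
  qed
  have "0 \<notin> range e"
    using orth by (metis imageE inner_zero_left zero_neq_one)
  then show ind: "independent (range e)"
    using orth inj by (intro pairwise_orthogonal_independent)
      (auto simp: pairwise_def orthogonal_def)
  show span: "span (range e) = UNIV"
    using card_ge_dim_independent[OF subset_UNIV ind] inj card
    by (auto simp: card_image)
  have rep: "representation (range e) x (e m) = x \<bullet> e m" for x m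
  proof -
    have "x = (\<Sum>b\<in>range e. representation (range e) x b *\<^sub>R b)"
      using real_vector.sum_representation_eq[OF ind, of x "range e"] span by simp
    also have "\<dots> = (\<Sum>i\<in>UNIV. representation (range e) x (e i) *\<^sub>R e i)"
      using inj by (simp add: sum.reindex)
    finally have "x \<bullet> e m = (\<Sum>i\<in>UNIV. representation (range e) x (e i) *\<^sub>R e i) \<bullet> e m"
      by simp
    then show ?thesis
      by (simp add: inner_sum_left orth if_distrib cong: if_cong)
  qed
  then show "representation (range e) x (e m) = x \<bullet> e m" .
  show *: "(\<Sum>m\<in>UNIV. (x \<bullet> e m) *\<^sub>R e m) = x" for x
    using real_vector.sum_representation_eq[OF ind, of x "range e"] span inj rep
    by (simp add: sum.reindex)
  show "(\<Sum>m\<in>UNIV. (x \<bullet> e m) * (y \<bullet> e m)) = x \<bullet> y"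
    using arg_cong[OF *[of x], of "\<lambda>z. z \<bullet> y"]
    by (simp add: inner_sum_left inner_commute[of y "e _"])
qed

subsection \<open>Standard bases\<close>

context
  fixes e :: "8 \<Rightarrow> octonion"
  assumes e: "standard_basis e"
begin

lemma standard_basis_one: "e 1 = oct_one"
  and standard_basis_inner: "e i \<bullet> e j = (if i = j then 1 else 0)"
  and standard_basis_mult: "\<exists>k. oct_mult (e i) (e j) = e k \<or> oct_mult (e i) (e j) = - e k"
  using e by (auto simp: standard_basis_def)

lemmas standard_basis_expansion =
  orthonormal_family_expansion[of e, OF standard_basis_inner, simplified]

lemma standard_basis_cnj: "oct_cnj (e i) = (if i = 1 then e i else - e i)"
  using standard_basis_inner[of i 1]
  by (auto simp: standard_basis_one oct_cnj_imaginary)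

text \<open>Moving everything except \<open>e k\<close> to the right of the inner product turns the hypothesis into
  the identity \<open>T\<close> between a product of two left and a product of two right multiplications.\<close>

lemma standard_basis_entries_distinct:
  assumes eq: "\<And>k l. oct_mult (e k) (oct_mult (e i) (e l)) \<bullet> e m =
      oct_mult (e k) (oct_mult (e i') (e l)) \<bullet> e m'"
  shows "i = i' \<and> m = m'"
proof -
  define v v' u u' c where "v = e m" and "v' = e m'" and "u = e i" and "u' = e i'"
    and "c = oct_mult (oct_cnj v') v"
  note defs = v_def v'_def u_def u'_def
  have unit: "v \<bullet> v = 1" "v' \<bullet> v' = 1" "u \<bullet> u = 1" "u' \<bullet> u' = 1"
    by (simp_all add: defs standard_basis_inner)
  then have nz: "v \<noteq> 0" "u \<noteq> 0"
    by auto
  have basis: "oct_mult v (oct_cnj (oct_mult u (e l))) = oct_mult v' (oct_cnj (oct_mult u' (e l)))" for l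
  proof -
    have "oct_mult v (oct_cnj (oct_mult u (e l))) \<bullet> e k =
        oct_mult v' (oct_cnj (oct_mult u' (e l))) \<bullet> e k" for k
      using eq[of k l] unfolding inner_oct_mult_right[of "e k"] defs by (simp add: inner_commute)
    then show ?thesis
      by (subst (1 2) standard_basis_expansion(4)[symmetric]) simp
  qed
  have lin: "linear (\<lambda>y. oct_mult v (oct_cnj (oct_mult u y)))" for v u
  proof -
    have "linear (oct_mult w)" for w
      using bilinear_oct_mult unfolding bilinear_def by blast
    from linear_compose[OF linear_compose[OF this linear_oct_cnj] this]
    show ?thesis by (simp add: o_def)
  qed
  have all: "oct_mult v (oct_cnj (oct_mult u y)) = oct_mult v' (oct_cnj (oct_mult u' y))" for y
    by (rule linear_eq_on_span[OF lin lin, of "range e"])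
      (use basis in \<open>auto simp: standard_basis_expansion(2)\<close>)
  \<comment> \<open>At \<open>y = (x u)*\<close> the left side of \<open>all\<close> collapses to
    \<open>v x\<close>; multiplying by \<open>v'*\<close> on the left cancels \<open>v'\<close> on
    the right side.\<close>
  have T: "oct_mult (oct_cnj v') (oct_mult v x) = oct_mult (oct_mult x u) (oct_cnj u')" for x
    using all[of "oct_cnj (oct_mult x u)"] oct_cancel_left[of v']
    by (simp add: oct_cnj_mult oct_cancel_right unit)
  have c: "oct_mult u (oct_cnj u') = c"
    using T[of oct_one] by (simp add: c_def)
  have "c \<bullet> oct_one = v \<bullet> v'" "c \<bullet> oct_one = u \<bullet> u'"
    by (simp add: c_def inner_oct_mult_left) (simp add: inner_oct_mult_right flip: c)
  \<comment> \<open>The real part of \<open>c\<close> is both \<open>v \<bullet> v'\<close> and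
    \<open>u \<bullet> u'\<close>, each 1 or 0 according to whether the indices agree.\<close>
  then have mi: "m = m' \<longleftrightarrow> i = i'"
    by (auto simp: defs standard_basis_inner split: if_splits)
  show ?thesis
  proof (rule ccontr)
    assume "\<not> ?thesis"
    then have ne: "m \<noteq> m'" "i \<noteq> i'" using mi by auto
    then have c1: "c \<bullet> oct_one = 0" and orth: "v' \<bullet> v = 0" "u \<bullet> u' = 0"
      using \<open>c \<bullet> oct_one = v \<bullet> v'\<close> by (auto simp: defs standard_basis_inner)
    obtain n where n: "c = e n \<or> c = - e n"
      using standard_basis_mult[of m' m] unfolding c_def defs standard_basis_cnj
      by (cases "m' = 1") (force simp: oct_mult_minus)+
    then have c0: "c \<noteq> 0"
      using standard_basis_inner[of n n] by auto
    have nocomm: "oct_mult x c \<noteq> oct_mult c x" if "x \<bullet> oct_one = 0" "x \<bullet> c = 0" "x \<noteq> 0" for x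
      using oct_imaginary_commute[OF that(1) c1 that(2)] that(3) c0 by auto
    \<comment> \<open>At most six of the eight indices are excluded, which leaves room for a basis
      element orthogonal to 1, \<open>c\<close>, \<open>v\<close>, \<open>v'\<close>,
      \<open>u\<close> and \<open>u'\<close>.\<close>
    have "card {1, n, m, m', i, i'} < CARD(8)"
      by (rule le_less_trans[OF card_length[of "[1, n, m, m', i, i']", simplified]]) simp
    then obtain j where j: "j \<notin> {1, n, m, m', i, i'}"
      by (metis UNIV_I finite subset_iff card_mono not_le)
    have "e j \<noteq> 0"
      using standard_basis_inner[of j j] by auto
    \<comment> \<open>If none of \<open>v\<close>, \<open>v'\<close>, \<open>u\<close>, \<open>u'\<close> is the unit, the two sides of \<open>T\<close> at this \<open>x\<close> are
      \<open>x c\<close> and \<open>c x\<close>, which are opposite. If one is the unit, that side of \<open>T\<close> is a multiplication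
      by \<open>c\<close> for every argument.\<close>
    define x where "x = e j"
    have x: "x \<bullet> oct_one = 0" "x \<bullet> c = 0" "x \<noteq> 0" "x \<bullet> v = 0" "x \<bullet> v' = 0" "x \<bullet> u = 0" "x \<bullet> u' = 0"
      using j n \<open>e j \<noteq> 0\<close>
      by (auto simp: x_def defs standard_basis_inner simp flip: standard_basis_one)
    have im: "k \<noteq> 1 \<Longrightarrow> e k \<bullet> oct_one = 0" for k
      by (simp add: standard_basis_inner flip: standard_basis_one)
    consider (left) "m \<noteq> 1" "m' \<noteq> 1" | (left1) "m = 1 \<or> m' = 1" by blast
    then show False
    proof cases
      case left
      then have vi: "v \<bullet> oct_one = 0" "v' \<bullet> oct_one = 0"
        by (simp_all add: defs im)
      note v_cnj = oct_cnj_imaginary[OF vi(1)] oct_cnj_imaginary[OF vi(2)]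
      consider (right) "i \<noteq> 1" "i' \<noteq> 1" | (right1) "i = 1 \<or> i' = 1" by blast
      then show False
      proof cases
        case right
        then have ui: "u \<bullet> oct_one = 0" "u' \<bullet> oct_one = 0"
          by (simp_all add: defs im)
        \<comment> \<open>Moving \<open>x\<close> leftwards past \<open>v\<close> and then past
          \<open>v'\<close> changes the sign twice.\<close>
        have "oct_mult (oct_cnj v') (oct_mult v x) = oct_mult x c"
          using oct_imaginary_anticommute(3)[OF x(1) vi(1) x(4)]
            oct_imaginary_anticommute(1)[OF x(1) vi(2) x(5), of v]
          by (simp add: c_def v_cnj oct_mult_minus)
        moreover have "oct_mult (oct_mult x u) (oct_cnj u') = oct_mult c x"
          using oct_imaginary_anticommute(3)[OF x(1) ui(1) x(6)]
            oct_imaginary_anticommute(2)[OF x(1) ui(2) x(7), of u]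
          by (simp add: oct_cnj_imaginary[OF ui(2)] oct_mult_minus flip: c)
        ultimately show False
          using T[of x] nocomm[OF x(1-3)] by simp
      next
        case right1
        then have R: "oct_mult (oct_mult y u) (oct_cnj u') = oct_mult y c" for y
          using c by (auto simp: defs standard_basis_one)
        \<comment> \<open>By \<open>T\<close> at \<open>v*\<close> and by right cancellation, both
          products equal \<open>v'*\<close>. Here \<open>v\<close> itself serves as the imaginary
          element orthogonal to \<open>c\<close>.\<close>
        have "oct_mult (oct_cnj v) c = oct_mult c (oct_cnj v)"
          using T[of "oct_cnj v"] unfolding R by (simp add: c_def oct_cancel_right unit)
        moreover have "v \<bullet> c = 0"
          using vi by (subst inner_commute) (simp add: c_def inner_oct_mult_right unit, simp add: v_cnj)
        ultimately show False
          using nocomm[of v] vi nz by (auto simp: v_cnj oct_mult_minus)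
      qed
    next
      case left1
      then have L: "oct_mult (oct_cnj v') (oct_mult v y) = oct_mult c y" for y
        by (auto simp: c_def defs standard_basis_one)
      consider (right) "i \<noteq> 1" "i' \<noteq> 1" | (right1) "i = 1 \<or> i' = 1" by blast
      then show False
      proof cases
        case right
        then have ui: "u \<bullet> oct_one = 0" "u' \<bullet> oct_one = 0"
          by (simp_all add: defs im)
        note u_cnj = oct_cnj_imaginary[OF ui(1)] oct_cnj_imaginary[OF ui(2)]
        \<comment> \<open>The mirror image, with \<open>T\<close> at \<open>u*\<close>: both
          products equal \<open>u'*\<close>.\<close>
        have "oct_mult (oct_cnj u) c = oct_mult c (oct_cnj u)"
          using T[of "oct_cnj u"] unfolding L by (simp add: oct_cancel_left unit flip: c)
        moreover have "u \<bullet> c = 0"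
          using ui by (subst inner_commute) (simp add: inner_oct_mult_left unit flip: c, simp add: u_cnj)
        ultimately show False
          using nocomm[of u] ui nz by (auto simp: u_cnj oct_mult_minus)
      next
        case right1
        then have "oct_mult (oct_mult x u) (oct_cnj u') = oct_mult x c"
          using c by (auto simp: defs standard_basis_one)
        then show False
          using T[of x] nocomm[OF x(1-3)] unfolding L by simp
      qed
    qed
  qed
qed

end

subsection \<open>Orthogonality over a ring of scalars\<close>

definition magic_coeff :: "(8 \<Rightarrow> octonion) \<Rightarrow> 8 \<Rightarrow> 8 \<Rightarrow> 8 \<Rightarrow> 8 \<Rightarrow> real" where
  "magic_coeff e i m k l = oct_mult (e k) (oct_mult (e i) (e l)) \<bullet> e m"

text \<open>The map \<open>h\<close> carries the real coefficients into the scalars: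
  \<open>Const\<close> yields the symbolic matrix, the identity the numerical one.\<close>

definition magic_square ::
    "(real \<Rightarrow> 'a) \<Rightarrow> (8 \<Rightarrow> octonion) \<Rightarrow> 'a ^ 8 \<Rightarrow> 'a ^ 8 \<Rightarrow> 'a::comm_ring_1 ^ 8 ^ 8" where
  "magic_square h e X Y =
     (\<chi> i m. \<Sum>k\<in>UNIV. \<Sum>l\<in>UNIV. h (magic_coeff e i m k l) * X $ k * Y $ l)"

locale real_ring_hom =
  fixes h :: "real \<Rightarrow> 'a::comm_ring_1"
  assumes hom_add: "h (x + y) = h x + h y"
    and hom_mult: "h (x * y) = h x * h y"
    and hom_one: "h 1 = 1"
begin

lemma hom_zero: "h 0 = 0"
  using hom_add[of 0 0] by simp

lemma hom_sum: "h (\<Sum>i\<in>I. f i) = (\<Sum>i\<in>I. h (f i))"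
  by (induction I rule: infinite_finite_induct) (simp_all add: hom_zero hom_add)

text \<open>The image of 1/2 under \<open>h\<close> is an inverse of 2.\<close>

lemma double_cancel:
  assumes "z + z = w + w"
  shows "z = (w :: 'a)"
proof -
  have "h (1/2) * (z + z) = z" for z :: 'a
  proof -
    have "h (1/2) * (z + z) = h (1/2 + 1/2) * z"
      by (simp only: hom_add distrib_left distrib_right)
    then show ?thesis by (simp add: hom_one)
  qed
  then show ?thesis
    using assms by metis
qed

text \<open>Adding the form to itself with indices interchanged leaves only the symmetrised
  coefficients, which are diagonal.\<close>

lemma quadratic_form_diagonal:
  fixes x :: "'n::finite \<Rightarrow> 'a"
  assumes "\<And>k k'. S k k' + S k' k = (if k = k' then 2 * s else 0)"
  shows "(\<Sum>k\<in>UNIV. \<Sum>k'\<in>UNIV. h (S k k') * (x k * x k')) = h s * (\<Sum>k\<in>UNIV. (x k)\<^sup>2)"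
    (is "?Q = ?R")
proof (rule double_cancel)
  have "?Q + ?Q = ?Q + (\<Sum>k\<in>UNIV. \<Sum>k'\<in>UNIV. h (S k' k) * (x k' * x k))"
    by (subst (2) sum.swap) simp
  also have "\<dots> = (\<Sum>k\<in>UNIV. \<Sum>k'\<in>UNIV. h (S k k' + S k' k) * (x k * x k'))"
    by (simp add: sum.distrib hom_add algebra_simps)
  also have "\<dots> = (\<Sum>k\<in>UNIV. \<Sum>k'\<in>UNIV. if k = k' then (h s + h s) * (x k)\<^sup>2 else 0)"
  proof -
    have "h (2 * s) = h s + h s"
      by (simp only: mult_2 hom_add)
    then show ?thesis
      unfolding assms by (intro sum.cong refl) (auto simp: hom_zero power2_eq_square)
  qed
  also have "\<dots> = ?R + ?R"
    by (simp add: sum_distrib_left mult.assoc)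
  finally show "?Q + ?Q = ?R + ?R" .
qed

text \<open>Diagonalises twice: for fixed \<open>l\<close>, \<open>l'\<close> the sum is a quadratic
  form in \<open>x\<close> with value governed by \<open>G l l'\<close>; what remains is a quadratic
  form in \<open>y\<close> with coefficients \<open>G\<close>.\<close>

lemma bilinear_form_products:
  fixes x y :: "'n::finite \<Rightarrow> 'a" and C C' :: "'m::finite \<Rightarrow> 'n \<Rightarrow> 'n \<Rightarrow> real"
  assumes "\<And>k k' l l'. (\<Sum>m\<in>UNIV. C m k l * C' m k' l') + (\<Sum>m\<in>UNIV. C m k' l * C' m k l') =
      (if k = k' then 2 * G l l' else 0)"
    and "\<And>l l'. G l l' + G l' l = (if l = l' then 2 * s else 0)"
  shows "(\<Sum>m\<in>UNIV. (\<Sum>k\<in>UNIV. \<Sum>l\<in>UNIV. h (C m k l) * x k * y l) *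
      (\<Sum>k\<in>UNIV. \<Sum>l\<in>UNIV. h (C' m k l) * x k * y l)) =
    h s * (\<Sum>k\<in>UNIV. (x k)\<^sup>2) * (\<Sum>l\<in>UNIV. (y l)\<^sup>2)" (is "?L = _")
proof -
  have "?L = (\<Sum>m\<in>UNIV. (\<Sum>l\<in>UNIV. \<Sum>k\<in>UNIV. h (C m k l) * x k * y l) *
      (\<Sum>l'\<in>UNIV. \<Sum>k'\<in>UNIV. h (C' m k' l') * x k' * y l'))"
    by (subst (2 4) sum.swap) simp
  also have "\<dots> = (\<Sum>m\<in>UNIV. \<Sum>l\<in>UNIV. \<Sum>l'\<in>UNIV. \<Sum>k\<in>UNIV. \<Sum>k'\<in>UNIV.
      h (C m k l * C' m k' l') * (x k * x k') * (y l * y l'))"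
    by (simp add: sum_product hom_mult mult_ac)
  also have "\<dots> = (\<Sum>l\<in>UNIV. \<Sum>l'\<in>UNIV. \<Sum>k\<in>UNIV. \<Sum>k'\<in>UNIV. \<Sum>m\<in>UNIV.
      h (C m k l * C' m k' l') * (x k * x k') * (y l * y l'))"
    by (simp only: sum.swap[of _ UNIV "UNIV :: 'm set"])
  also have "\<dots> = (\<Sum>l\<in>UNIV. \<Sum>l'\<in>UNIV. (\<Sum>k\<in>UNIV. \<Sum>k'\<in>UNIV.
      h (\<Sum>m\<in>UNIV. C m k l * C' m k' l') * (x k * x k')) * (y l * y l'))"
    by (simp add: hom_sum sum_distrib_right)
  also have "\<dots> = (\<Sum>l\<in>UNIV. \<Sum>l'\<in>UNIV. h (G l l') * (\<Sum>k\<in>UNIV. (x k)\<^sup>2) * (y l * y l'))"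
  proof -
    have "(\<Sum>k\<in>UNIV. \<Sum>k'\<in>UNIV. h (\<Sum>m\<in>UNIV. C m k l * C' m k' l') * (x k * x k')) =
        h (G l l') * (\<Sum>k\<in>UNIV. (x k)\<^sup>2)" for l l'
      by (rule quadratic_form_diagonal) (rule assms)
    then show ?thesis by simp
  qed
  also have "\<dots> = (\<Sum>k\<in>UNIV. (x k)\<^sup>2) * (\<Sum>l\<in>UNIV. \<Sum>l'\<in>UNIV. h (G l l') * (y l * y l'))"
    by (simp add: sum_distrib_left mult_ac)
  also have "(\<Sum>l\<in>UNIV. \<Sum>l'\<in>UNIV. h (G l l') * (y l * y l')) = h s * (\<Sum>l\<in>UNIV. (y l)\<^sup>2)"
    by (rule quadratic_form_diagonal) (rule assms)
  finally show ?thesis by (simp add: mult_ac)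
qed

lemma magic_square_orthogonal:
  assumes e: "standard_basis e"
  shows "magic_square h e X Y ** transpose (magic_square h e X Y) = mat (norm_form X * norm_form Y)"
    and "transpose (magic_square h e X Y) ** magic_square h e X Y = mat (norm_form X * norm_form Y)"
proof -
  note basis = standard_basis_inner[OF e]
  \<comment> \<open>Parseval over the column index. The outer factors \<open>e k\<close> are
    eliminated first, then the \<open>e l\<close>, leaving \<open>e i \<bullet> e j\<close>.\<close>
  have rows: "(\<Sum>m\<in>UNIV. magic_coeff e i m k l * magic_coeff e j m k' l') =
      oct_mult (e k) (oct_mult (e i) (e l)) \<bullet> oct_mult (e k') (oct_mult (e j) (e l'))" for i j k l k' l'
    by (simp add: magic_coeff_def standard_basis_expansion(5)[OF e])
  have "(\<Sum>m\<in>UNIV. magic_square h e X Y $ i $ m * magic_square h e X Y $ j $ m) =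
      h (e i \<bullet> e j) * (\<Sum>k\<in>UNIV. (X $ k)\<^sup>2) * (\<Sum>l\<in>UNIV. (Y $ l)\<^sup>2)" for i j
    unfolding magic_square_def vec_lambda_beta
    by (rule bilinear_form_products[where G = "\<lambda>l l'. oct_mult (e i) (e l) \<bullet> oct_mult (e j) (e l')"])
      (simp_all add: rows oct_mult_inner_left oct_mult_inner_right basis)
  then show "magic_square h e X Y ** transpose (magic_square h e X Y) = mat (norm_form X * norm_form Y)"
    by (simp add: vec_eq_iff matrix_matrix_mult_def transpose_def mat_def norm_form_def
        basis hom_zero hom_one)
  \<comment> \<open>The summation index \<open>i\<close> sits innermost, so both \<open>e k\<close>
    and \<open>e l\<close> are first moved across the inner product.\<close>
  have cols: "(\<Sum>i\<in>UNIV. magic_coeff e i m k l * magic_coeff e i n k' l') =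
      oct_mult (oct_mult (oct_cnj (e k)) (e m)) (oct_cnj (e l)) \<bullet>
      oct_mult (oct_mult (oct_cnj (e k')) (e n)) (oct_cnj (e l'))" for m n k l k' l'
  proof -
    have "magic_coeff e i m k l = oct_mult (oct_mult (oct_cnj (e k)) (e m)) (oct_cnj (e l)) \<bullet> e i"
      for i m k l
      unfolding magic_coeff_def inner_oct_mult_left[of "e k"] inner_oct_mult_right[of "e i" "e l"]
      by (rule inner_commute)
    then show ?thesis
      by (simp add: standard_basis_expansion(5)[OF e])
  qed
  have "(\<Sum>i\<in>UNIV. magic_square h e X Y $ i $ m * magic_square h e X Y $ i $ n) =
      h (e m \<bullet> e n) * (\<Sum>l\<in>UNIV. (Y $ l)\<^sup>2) * (\<Sum>k\<in>UNIV. (X $ k)\<^sup>2)" for m n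
  proof -
    \<comment> \<open>In the column form \<open>e l\<close> is the outer factor, so \<open>Y\<close>
      takes the role of the variable eliminated first.\<close>
    have swap: "magic_square h e X Y $ i $ m =
        (\<Sum>l\<in>UNIV. \<Sum>k\<in>UNIV. h (magic_coeff e i m k l) * Y $ l * X $ k)" for i m
      unfolding magic_square_def vec_lambda_beta by (subst sum.swap) (simp add: mult_ac)
    show ?thesis
      unfolding swap
      by (rule bilinear_form_products[where
            G = "\<lambda>k k'. oct_mult (oct_cnj (e k)) (e m) \<bullet> oct_mult (oct_cnj (e k')) (e n)"])
        (simp_all add: cols oct_mult_inner_left oct_mult_inner_right inner_oct_cnj basis)
  qed
  then show "transpose (magic_square h e X Y) ** magic_square h e X Y = mat (norm_form X * norm_form Y)"
    by (simp add: vec_eq_iff matrix_matrix_mult_def transpose_def mat_def norm_form_def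
        basis hom_zero hom_one mult_ac)
qed

end

subsection \<open>The symbolic matrix\<close>

interpretation Const: real_ring_hom Const
  by unfold_locales (simp_all add: Const_def single_add mult_single)

interpretation real_id: real_ring_hom "\<lambda>x::real. x"
  by unfold_locales simp_all

lemma symM_eq_magic_square:
  assumes e: "standard_basis e"
  shows "symM e = magic_square Const e symA symP"
proof -
  note rep = standard_basis_expansion(3)[OF e]
  have inner: "poly_oct_mult e (of_oct e (e i)) symP $ n =
      (\<Sum>l\<in>UNIV. Const (oct_mult (e i) (e l) \<bullet> e n) * symP $ l)" for i n
  proof -
    have "poly_oct_mult e (of_oct e (e i)) symP $ n =
        (\<Sum>k\<in>UNIV. if i = k then \<Sum>l\<in>UNIV. Const (oct_mult (e k) (e l) \<bullet> e n) * symP $ l else 0)"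
      unfolding poly_oct_mult_def of_oct_def vec_lambda_beta rep standard_basis_inner[OF e]
      by (intro sum.cong) (auto simp: Const.hom_zero Const.hom_one)
    then show ?thesis by simp
  qed
  \<comment> \<open>Parseval over the intermediate index \<open>n\<close> composes the two
    multiplications.\<close>
  have coeff: "(\<Sum>n\<in>UNIV. (oct_mult (e i) (e l) \<bullet> e n) * (oct_mult (e k) (e n) \<bullet> e m)) =
      magic_coeff e i m k l" for i l k m
    unfolding magic_coeff_def inner_oct_mult_left[of "e k"]
    by (simp add: inner_commute[of "e _"] standard_basis_expansion(5)[OF e])
  have "symM e $ i $ m = magic_square Const e symA symP $ i $ m" for i m
  proof -
    have "symM e $ i $ m = (\<Sum>k\<in>UNIV. \<Sum>n\<in>UNIV. \<Sum>l\<in>UNIV.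
        Const ((oct_mult (e i) (e l) \<bullet> e n) * (oct_mult (e k) (e n) \<bullet> e m)) * symA $ k * symP $ l)"
      unfolding symM_def vec_lambda_beta poly_oct_mult_def[of e symA] rep inner
      by (simp add: sum_distrib_left Const.hom_mult mult_ac)
    also have "\<dots> = (\<Sum>k\<in>UNIV. \<Sum>l\<in>UNIV. \<Sum>n\<in>UNIV.
        Const ((oct_mult (e i) (e l) \<bullet> e n) * (oct_mult (e k) (e n) \<bullet> e m)) * symA $ k * symP $ l)"
      by (intro sum.cong refl sum.swap)
    also have "\<dots> = magic_square Const e symA symP $ i $ m"
      unfolding magic_square_def vec_lambda_beta
      by (simp only: coeff[symmetric] Const.hom_sum sum_distrib_right)
    finally show ?thesis .
  qed
  then show ?thesis by (simp add: vec_eq_iff)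
qed

section \<open>Coefficients of the entries\<close>

definition bimonomial :: "8 \<Rightarrow> 8 \<Rightarrow> (8 + 8) \<Rightarrow>\<^sub>0 nat" where
  "bimonomial k l = Poly_Mapping.single (Inl k) 1 + Poly_Mapping.single (Inr l) 1"

lemma bimonomial_eq_iff: "bimonomial k l = bimonomial k' l' \<longleftrightarrow> k = k' \<and> l = l'"
proof
  assume eq: "bimonomial k l = bimonomial k' l'"
  show "k = k' \<and> l = l'"
    using arg_cong[OF eq, of "\<lambda>m. Poly_Mapping.lookup m (Inl k)"]
      arg_cong[OF eq, of "\<lambda>m. Poly_Mapping.lookup m (Inr l)"]
    by (auto simp: bimonomial_def lookup_add lookup_single when_def split: if_splits)
qed simp

lemma magic_square_Const_nth:
  "magic_square Const e symA symP $ i $ m =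
     (\<Sum>k\<in>UNIV. \<Sum>l\<in>UNIV. Poly_Mapping.single (bimonomial k l) (magic_coeff e i m k l))"
  by (simp add: magic_square_def symA_def symP_def Const_def Var_def bimonomial_def mult_single)

text \<open>Distinct index pairs give distinct monomials, so no terms merge. Equal entries therefore
  have equal coefficients throughout.\<close>

lemma lookup_magic_square:
  "Poly_Mapping.lookup (magic_square Const e symA symP $ i $ m) (bimonomial k l) =
     magic_coeff e i m k l"
proof -
  have "Poly_Mapping.lookup (magic_square Const e symA symP $ i $ m) (bimonomial k l) =
      (\<Sum>k'\<in>UNIV. if k' = k then \<Sum>l'\<in>UNIV. if l' = l then magic_coeff e i m k' l' else 0 else 0)"
    unfolding magic_square_Const_nth lookup_sum lookup_single when_def bimonomial_eq_iff
    by (intro sum.cong) auto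
  then show ?thesis by simp
qed

text \<open>Two multiplications of basis elements give a basis element up to sign, so the
  coefficient is 0, 1 or -1.\<close>

lemma magic_coeff_Ints:
  assumes "standard_basis e"
  shows "magic_coeff e i m k l \<in> \<int>"
proof -
  obtain n where n: "oct_mult (e i) (e l) = e n \<or> oct_mult (e i) (e l) = - e n"
    using standard_basis_mult[OF assms] by blast
  obtain j where "oct_mult (e k) (e n) = e j \<or> oct_mult (e k) (e n) = - e j"
    using standard_basis_mult[OF assms] by blast
  with n show ?thesis
    by (auto simp: magic_coeff_def oct_mult_minus standard_basis_inner[OF assms])
qed

section \<open>Evaluation at numerical points\<close>

lemma eval_poly_superset:
  assumes "finite S" "Poly_Mapping.keys f \<subseteq> S"
  shows "eval_poly \<nu> f =
    (\<Sum>m\<in>S. Poly_Mapping.lookup f m * (\<Prod>x\<in>UNIV. \<nu> x ^ Poly_Mapping.lookup m x))"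
  unfolding eval_poly_def using assms by (intro sum.mono_neutral_left) (auto simp: in_keys_iff)

lemma eval_poly_add: "eval_poly \<nu> (f + g) = eval_poly \<nu> f + eval_poly \<nu> g"
proof -
  let ?S = "Poly_Mapping.keys f \<union> Poly_Mapping.keys g"
  show ?thesis
    \<comment> \<open>Cancellation may shrink the support of \<open>f + g\<close>, so all three
      evaluations run over the union of the supports.\<close>
    using eval_poly_superset[of ?S "f + g" \<nu>] eval_poly_superset[of ?S f \<nu>]
      eval_poly_superset[of ?S g \<nu>] keys_add[of f g]
    by (simp add: lookup_add distrib_right sum.distrib)
qed

lemma eval_poly_sum: "eval_poly \<nu> (\<Sum>i\<in>I. f i) = (\<Sum>i\<in>I. eval_poly \<nu> (f i))"
  by (induction I rule: infinite_finite_induct) (simp_all add: eval_poly_add, simp_all add: eval_poly_def)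

lemma eval_poly_bimonomial:
  "eval_poly \<nu> (Poly_Mapping.single (bimonomial k l) c) = c * \<nu> (Inl k) * \<nu> (Inr l)"
proof -
  have single: "(\<Prod>x\<in>UNIV. \<nu> x ^ Poly_Mapping.lookup (Poly_Mapping.single a 1) x) = \<nu> a" for a
  proof -
    have "(\<Prod>x\<in>UNIV. \<nu> x ^ Poly_Mapping.lookup (Poly_Mapping.single a 1) x) =
        (\<Prod>x\<in>UNIV. if x = a then \<nu> x else 1)"
      by (intro prod.cong) (auto simp: lookup_single when_def)
    then show ?thesis by simp
  qed
  show ?thesis
    \<comment> \<open>Summing over the superset also covers \<open>c = 0\<close>, where the support
      is empty.\<close>
    by (subst eval_poly_superset[of "{bimonomial k l}"])
      (simp_all add: bimonomial_def lookup_add power_add prod.distrib single[simplified])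
qed

lemma subst_matrix_symM:
  assumes "standard_basis e"
  shows "subst_matrix A0 P0 (symM e) = magic_square (\<lambda>x. x) e A0 P0"
  by (simp add: vec_eq_iff subst_matrix_def symM_eq_magic_square[OF assms] magic_square_Const_nth
      eval_poly_sum eval_poly_bimonomial) (simp add: magic_square_def)

theorem theorem1:
  fixes e :: "8 \<Rightarrow> octonion"
  assumes "standard_basis e"
  shows "semi_magic_square_of_squares int_polys (norm_form symA * norm_form symP) (symM e) \<and>
    (\<forall>A0 P0 :: real ^ 8.
       (\<forall>i. A0 $ i \<in> \<rat>) \<and> (\<forall>i. P0 $ i \<in> \<rat>) \<and>
       entries_in \<int> (subst_matrix A0 P0 (symM e)) \<and>
       distinct_entries (subst_matrix A0 P0 (symM e)) \<longrightarrow>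
       semi_magic_square_of_squares \<int> (norm_form A0 * norm_form P0)
         (subst_matrix A0 P0 (symM e)))"
proof (intro conjI allI impI)
  let ?M = "magic_square Const e symA symP"
  have "entries_in int_polys ?M"
    unfolding entries_in_def int_polys_def magic_square_Const_nth
    by (auto simp: lookup_sum lookup_single when_def magic_coeff_Ints[OF assms] intro!: Ints_sum)
  moreover have "distinct_entries ?M"
    unfolding distinct_entries_def
  proof (intro allI impI)
    fix i m i' m' assume "?M $ i $ m = ?M $ i' $ m'"
    then have "magic_coeff e i m k l = magic_coeff e i' m' k l" for k l
      using lookup_magic_square by metis
    then show "i = i' \<and> m = m'"
      by (intro standard_basis_entries_distinct[OF assms]) (simp add: magic_coeff_def)
  qed
  ultimately show "semi_magic_square_of_squares int_polys (norm_form symA * norm_form symP) (symM e)"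
    unfolding semi_magic_square_of_squares_def symM_eq_magic_square[OF assms]
    using Const.magic_square_orthogonal[OF assms] by blast
next
  fix A0 P0 :: "real ^ 8"
  assume "(\<forall>i. A0 $ i \<in> \<rat>) \<and> (\<forall>i. P0 $ i \<in> \<rat>) \<and>
    entries_in \<int> (subst_matrix A0 P0 (symM e)) \<and> distinct_entries (subst_matrix A0 P0 (symM e))"
  then show "semi_magic_square_of_squares \<int> (norm_form A0 * norm_form P0)
      (subst_matrix A0 P0 (symM e))"
    \<comment> \<open>Integrality and distinctness are hypotheses on the substituted matrix; the two
      products are the orthogonality result for the identity homomorphism.\<close>
    unfolding semi_magic_square_of_squares_def subst_matrix_symM[OF assms]
    using real_id.magic_square_orthogonal[OF assms] by blast
qed

end
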